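(* Let $X$ be a real Banach space, let $G\subset\mathbb{R}^m$ be a bounded set with $G^{o}\neq\emptyset$ and $|G\setminus G^{o}|=0$, and let $I_0\in\mathcal{I}$ be a closed non-degenerate interval with $G\subset I_0$. Let $f:G\to X$ be a function, let $F:\mathcal{I}_G\to X$ be an additive interval function, and let $f_0:I_0\to X$ be defined by $f_0(t)=f(t)$ if $t\in G$ and $f_0(t)=0$ if $t\in I_0\setminus G$. Then the following statements are equivalent: (i) $f$ is Dunford-Henstock-Kurzweil integrable on $G$ with the primitive $F$; (ii) $f_0$ is Henstock-Kurzweil integrable on $I_0$ with a primitive $F_0:\mathcal{I}_{I_0}\to X$ such that $$F_0(I)=\sum_{k:|I\cap C_k|>0}F(I\cap C_k)\quad\text{for all } I\in\mathcal{I}_{I_0},$$ whenever $(C_k)\in\mathscr{D}_{G^{o}}$, and $F$ is a Dunford-function; (iii) $F$ is a Dunford-function and has $\mathcal{HK}$-negligible variation outside of $G^{o}$, and given any division $(C_k)\in\mathscr{D}_{G^{o}}$, for each $k$ the restriction $f|_{C_k}$ is Henstock-Kurzweil integrable on $C_k$ with the primitive $F|_{\mathcal{I}_{C_k}}$.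
   Context: $\mathbb{R}^m$ carries the maximum norm; $B_m(t,r)$ is the open ball with center $t$ and radius $r>0$; $|A|$ is the Lebesgue measure of $A$; $E^{o}$ is the interior of $E$; $\mathbb{1}_A$ is the characteristic function of $A$. Intervals. A closed non-degenerate interval in $\mathbb{R}^m$ is a set $\prod_{j=1}^m[a_j,b_j]$ with $-\infty<a_j<b_j<+\infty$ for all $j$. $\mathcal{I}$ is the family of all of them, and $\mathcal{I}_E$ is the family of those contained in $E$. Intervals $I,J$ are non-overlapping if $I^{o}\cap J^{o}=\emptyset$. A function $F:\mathcal{I}_E\to X$ is an additive interval function if $F(I\cup J)=F(I)+F(J)$ whenever $I,J\in\mathcal{I}_E$ are non-overlapping and $I\cup J\in\mathcal{I}_E$. Partitions. An $\mathcal{HK}$-partition in $E$ is a finite collection of pairs $(t_i,I_i)$, $i=1,\dots,p$, with $I_i\in\mathcal{I}_E$, $t_i\in I_i$ and the $I_i$ pairwise non-overlapping. It is an $\mathcal{HK}$-partition of $E$ if also $\bigcup_i I_i=E$. It is $Z$-tagged if all $t_i\in Z$. A gauge on $Z$ is a function $\delta:Z\to(0,+\infty)$; a partition with tags in the domain of $\delta$ is $\delta$-fine if $I_i\subset B_m(t_i,\delta(t_i))$ for all $i$. Henstock-Kurzweil integral. For $W\in\mathcal{I}$, $f:W\to X$ is Henstock-Kurzweil integrable on $W$ if there is $x_f\in X$ such that for every $\varepsilon>0$ there is a gauge $\delta$ on $W$ with $\|\sum_{(t,I)\in\pi}f(t)|I|-x_f\|<\varepsilon$ for every $\delta$-fine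 $\mathcal{HK}$-partition $\pi$ of $W$; then $(HK)\int_W f\,d\lambda=x_f$. In this case $f\cdot\mathbb{1}_I$ is Henstock-Kurzweil integrable on $W$ for every $I\in\mathcal{I}_W$, with integral denoted $(HK)\int_I f\,d\lambda$, and the primitive of $f$ is the additive interval function $\mathcal{I}_W\to X$, $I\mapsto(HK)\int_I f\,d\lambda$. Divisions. Let $E\subset\mathbb{R}^m$ be bounded and Lebesgue measurable with $E^{o}\neq\emptyset$. $\mathscr{P}_E$ is the family of all divisions in $E$, i.e. sequences $(I_k)_{k\ge1}$ of pairwise non-overlapping intervals in $\mathcal{I}_E$. $\mathscr{D}_E$ is the family of all divisions of $E$, i.e. those $(I_k)\in\mathscr{P}_E$ with $E=\bigcup_{k=1}^{\infty}I_k$. (The same notation is used for $E^{o}$.) Dunford-function. An additive interval function $F:\mathcal{I}_E\to X$ is a Dunford-function if for every $(I_k)\in\mathscr{P}_E$: (a) the series $\sum_{k:|I\cap I_k|>0}F(I\cap I_k)$ is unconditionally convergent in $X$ for each $I\in\mathcal{I}$; and (b) if $(I_k)\in\mathscr{D}_{E^{o}}$, then $F(I)=\sum_{k:|I\cap I_k|>0}F(I\cap I_k)$ for all $I\in\mathcal{I}_E$. Negligible variation. An additive interval function $F:\mathcal{I}_E\to X$ has $\mathcal{HK}$-negligible variation over $Z\subset\mathbb{R}^m$ if for each $\varepsilon>0$ there is a gauge $\delta_\varepsilon$ on $Z$ such that for each $Z$-tagged $\delta_\varepsilon$-fine $\mathcal{HK}$-partition $\pi$ in $\mathbb{R}^m$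 and every $(I_k)\in\mathscr{D}_{E^{o}}$: the series $\sum_{k:|I\cap I_k|>0}F(I\cap I_k)$ is unconditionally convergent in $X$ for each $(t,I)\in\pi$, and $\big\|\sum_{(t,I)\in\pi}\big(\sum_{k:|I\cap I_k|>0}F(I\cap I_k)\big)\big\|<\varepsilon$. $F$ has $\mathcal{HK}$-negligible variation outside of $E^{o}$ if it has $\mathcal{HK}$-negligible variation over $\mathbb{R}^m\setminus E^{o}$. Dunford-Henstock-Kurzweil integral. $f:E\to X$ is Dunford-Henstock-Kurzweil integrable on $E$ with the primitive $F:\mathcal{I}_E\to X$ if: for each $\varepsilon>0$ there is a gauge $\delta_\varepsilon$ on $E^{o}$ such that $\|\sum_{(t,I)\in\pi}(f(t)|I|-F(I))\|<\varepsilon$ for each $\delta_\varepsilon$-fine $\mathcal{HK}$-partition $\pi$ in $E^{o}$; $F$ is a Dunford-function; and $F$ has $\mathcal{HK}$-negligible variation outside of $E^{o}$. *)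

theory Defs
  imports "HOL-Analysis.Analysis"
begin

text \<open>
  The space R^m is the type \<^typ>\<open>real ^ 'm\<close>, and the Lebesgue measure of A is
  \<^term>\<open>measure lebesgue A\<close>. An interval function on the intervals contained in E is
  represented by a total function on sets, of which only the values on \<open>intervals_in E\<close>
  are ever used.
\<close>

definition intervals_in :: "(real ^ 'm) set \<Rightarrow> (real ^ 'm) set set" where
  "intervals_in E = {I. (\<exists>a b. (\<forall>j. a $ j < b $ j) \<and> I = cbox a b) \<and> I \<subseteq> E}"

definition non_overlapping :: "(real ^ 'm) set \<Rightarrow> (real ^ 'm) set \<Rightarrow> bool" where
  "non_overlapping I J \<longleftrightarrow> interior I \<inter> interior J = {}"

definition additive_interval_function ::
    "(real ^ 'm) set \<Rightarrow> ((real ^ 'm) set \<Rightarrow> 'a::real_normed_vector) \<Rightarrow> bool" where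
  "additive_interval_function E F \<longleftrightarrow>
     (\<forall>I\<in>intervals_in E. \<forall>J\<in>intervals_in E.
        non_overlapping I J \<and> I \<union> J \<in> intervals_in E \<longrightarrow> F (I \<union> J) = F I + F J)"

definition max_ball :: "real ^ 'm \<Rightarrow> real \<Rightarrow> (real ^ 'm) set" where
  "max_ball t r = {s. infnorm (s - t) < r}"

text \<open>
  The library's partial tagged divisions admit degenerate boxes; these are excluded here.
  A finite set of pairs suffices, because a non-degenerate interval overlaps itself.
\<close>

definition hk_partition_in ::
    "(real ^ 'm) set \<Rightarrow> ((real ^ 'm) \<times> (real ^ 'm) set) set \<Rightarrow> bool" where
  "hk_partition_in E \<pi> \<longleftrightarrow>
     \<pi> tagged_partial_division_of E \<and> (\<forall>(t, I)\<in>\<pi>. I \<in> intervals_in E)"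

definition gauge_fun_on :: "(real ^ 'm) set \<Rightarrow> (real ^ 'm \<Rightarrow> real) \<Rightarrow> bool" where
  "gauge_fun_on Z \<delta> \<longleftrightarrow> (\<forall>t\<in>Z. 0 < \<delta> t)"

definition fine_partition ::
    "(real ^ 'm \<Rightarrow> real) \<Rightarrow> ((real ^ 'm) \<times> (real ^ 'm) set) set \<Rightarrow> bool" where
  "fine_partition \<delta> \<pi> \<longleftrightarrow> (\<forall>(t, I)\<in>\<pi>. I \<subseteq> max_ball t (\<delta> t))"

text \<open>
  The Henstock--Kurzweil integral is the library's \<^const>\<open>has_integral\<close>. Its gauges assign
  to each point an open neighbourhood instead of a radius, and degenerate boxes contribute
  zero to its sums, so it is the same integral on non-degenerate intervals.
\<close>

definition hk_integrable_with_primitive ::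
    "(real ^ 'm) set \<Rightarrow> (real ^ 'm \<Rightarrow> 'a::banach) \<Rightarrow> ((real ^ 'm) set \<Rightarrow> 'a) \<Rightarrow> bool" where
  "hk_integrable_with_primitive W f F \<longleftrightarrow>
     f integrable_on W \<and>
     (\<forall>I\<in>intervals_in W. ((\<lambda>t. indicat_real I t *\<^sub>R f t) has_integral F I) W)"

definition divisions_in :: "(real ^ 'm) set \<Rightarrow> (nat \<Rightarrow> (real ^ 'm) set) set" where
  "divisions_in E =
     {C. (\<forall>k. C k \<in> intervals_in E) \<and> (\<forall>j k. j \<noteq> k \<longrightarrow> non_overlapping (C j) (C k))}"

definition divisions_of :: "(real ^ 'm) set \<Rightarrow> (nat \<Rightarrow> (real ^ 'm) set) set" where
  "divisions_of E = {C \<in> divisions_in E. E = (\<Union>k. C k)}"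

definition meeting_indices ::
    "(real ^ 'm) set \<Rightarrow> (nat \<Rightarrow> (real ^ 'm) set) \<Rightarrow> nat set" where
  "meeting_indices I C = {k. measure lebesgue (I \<inter> C k) > 0}"

text \<open>
  Unconditional convergence of the series of all F(I \<inter> C k) with k in
  \<open>meeting_indices I C\<close> is the library's \<^const>\<open>summable_on\<close>, and its sum is given by
  \<^const>\<open>has_sum\<close> and \<^const>\<open>infsum\<close>. Each such intersection is a non-degenerate interval
  contained in C k, even if I is not contained in E.
\<close>

definition dunford_function ::
    "(real ^ 'm) set \<Rightarrow> ((real ^ 'm) set \<Rightarrow> 'a::banach) \<Rightarrow> bool" where
  "dunford_function E F \<longleftrightarrow>
     additive_interval_function E F \<and>
     (\<forall>C\<in>divisions_in E.
        (\<forall>I\<in>intervals_in UNIV. (\<lambda>k. F (I \<inter> C k)) summable_on meeting_indices I C) \<and>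
        (C \<in> divisions_of (interior E) \<longrightarrow>
          (\<forall>I\<in>intervals_in E. ((\<lambda>k. F (I \<inter> C k)) has_sum F I) (meeting_indices I C))))"

definition hk_negligible_variation_over ::
    "(real ^ 'm) set \<Rightarrow> ((real ^ 'm) set \<Rightarrow> 'a::banach) \<Rightarrow> (real ^ 'm) set \<Rightarrow> bool" where
  "hk_negligible_variation_over E F Z \<longleftrightarrow>
     additive_interval_function E F \<and>
     (\<forall>\<epsilon>>0. \<exists>\<delta>. gauge_fun_on Z \<delta> \<and>
       (\<forall>\<pi>. hk_partition_in UNIV \<pi> \<and> fst ` \<pi> \<subseteq> Z \<and> fine_partition \<delta> \<pi> \<longrightarrow>
         (\<forall>C\<in>divisions_of (interior E).
            (\<forall>(t, I)\<in>\<pi>. (\<lambda>k. F (I \<inter> C k)) summable_on meeting_indices I C) \<and>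
            norm (\<Sum>(t, I)\<in>\<pi>. \<Sum>\<^sub>\<infinity>k\<in>meeting_indices I C. F (I \<inter> C k)) < \<epsilon>)))"

definition hk_negligible_variation_outside_interior ::
    "(real ^ 'm) set \<Rightarrow> ((real ^ 'm) set \<Rightarrow> 'a::banach) \<Rightarrow> bool" where
  "hk_negligible_variation_outside_interior E F \<longleftrightarrow>
     hk_negligible_variation_over E F (UNIV - interior E)"

definition dhk_integrable_with_primitive ::
    "(real ^ 'm) set \<Rightarrow> (real ^ 'm \<Rightarrow> 'a::banach) \<Rightarrow> ((real ^ 'm) set \<Rightarrow> 'a) \<Rightarrow> bool" where
  "dhk_integrable_with_primitive E f F \<longleftrightarrow>
     (\<forall>\<epsilon>>0. \<exists>\<delta>. gauge_fun_on (interior E) \<delta> \<and>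
       (\<forall>\<pi>. hk_partition_in (interior E) \<pi> \<and> fine_partition \<delta> \<pi> \<longrightarrow>
          norm (\<Sum>(t, I)\<in>\<pi>. measure lebesgue I *\<^sub>R f t - F I) < \<epsilon>)) \<and>
     dunford_function E F \<and>
     hk_negligible_variation_outside_interior E F"

end

theory Submission
  imports Defs
begin

text \<open>
  Let U be the interior of G. Summing F over the traces of a fixed division of U extends F to an
  interval function \<open>\<Phi>\<close> on all of R^m, which does not depend on the division and is additive under
  hyperplane cuts. Both (i) and (ii) say that f, set to 0 outside U, has the indefinite integral
  \<open>\<Phi>\<close>: for (ii) this is a change on a null set, and for (i) one splits a tagged partition into the
  tags in U, where \<open>\<Phi>\<close> may be replaced by F, and the tags outside U, where only \<open>\<Phi>\<close> contributes.
  For (iii), every interval contained in U is a member of some division of U, so the hypothesis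
  makes f integrable on every such interval, and the Henstock lemmas of countably many
  intervals covering U can be glued.
\<close>

subsection \<open>Intervals and divisions\<close>

text \<open>Strict inequality of all endpoints means that the open box, which is the interior of
  \<open>cbox a b\<close>, is nonempty. This form without endpoints is preserved by intersections as
  long as the interior does not vanish.\<close>

lemma intervals_in_iff:
  "I \<in> intervals_in E \<longleftrightarrow> (\<exists>a b. I = cbox a b) \<and> interior I \<noteq> {} \<and> I \<subseteq> E"
proof
  assume "I \<in> intervals_in E"
  then obtain a b where "\<forall>j. a $ j < b $ j" and I: "I = cbox a b" "I \<subseteq> E"
    unfolding intervals_in_def by blast
  then have "box a b \<noteq> {}"
    by (simp add: interval_ne_empty_cart(2))
  then show "(\<exists>a b. I = cbox a b) \<and> interior I \<noteq> {} \<and> I \<subseteq> E"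
    using I by auto
next
  assume "(\<exists>a b. I = cbox a b) \<and> interior I \<noteq> {} \<and> I \<subseteq> E"
  then obtain a b where I: "I = cbox a b" "interior I \<noteq> {}" "I \<subseteq> E"
    by blast
  then have "\<forall>j. a $ j < b $ j"
    by (metis interior_cbox interval_ne_empty_cart(2))
  then show "I \<in> intervals_in E"
    using I unfolding intervals_in_def by blast
qed

lemma intervals_in_mono: "I \<in> intervals_in E \<Longrightarrow> E \<subseteq> E' \<Longrightarrow> I \<in> intervals_in E'"
  unfolding intervals_in_iff by blast

lemma intervals_in_Int:
  assumes "I \<in> intervals_in A" "J \<in> intervals_in B" "interior (I \<inter> J) \<noteq> {}"
  shows "I \<inter> J \<in> intervals_in (A \<inter> B)"
proof -
  obtain a b c d where "I = cbox a b" "J = cbox c d"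
    using assms by (auto simp: intervals_in_iff)
  then have "\<exists>a b. I \<inter> J = cbox a b"
    by (simp only: Int_interval) blast
  moreover have "I \<inter> J \<subseteq> A \<inter> B"
    using assms(1,2) unfolding intervals_in_iff by blast
  ultimately show ?thesis
    using assms(3) by (simp only: intervals_in_iff) simp
qed

text \<open>A convex set with empty interior is a null set, and conversely. This turns the
  topological notion of non-overlapping into a measure-theoretic one that survives countable
  unions.\<close>

lemma negligible_Int_intervals:
  assumes "I \<in> intervals_in A" "J \<in> intervals_in B"
  shows "negligible (I \<inter> J) \<longleftrightarrow> interior (I \<inter> J) = {}"
proof (rule negligible_convex_interior)
  have "convex I" "convex J"
    using assms by (auto simp: intervals_in_iff)
  then show "convex (I \<inter> J)"
    by (rule convex_Int)
qed

lemma ball_subset_max_ball: "ball t r \<subseteq> max_ball t r"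
proof
  fix s assume "s \<in> ball t r"
  then show "s \<in> max_ball t r"
    using infnorm_le_norm[of "s - t"] by (simp add: max_ball_def dist_norm norm_minus_commute)
qed

text \<open>The Euclidean norm is at most \<open>sqrt m\<close> times the maximum norm, so the
  radius is divided by this constant. Together with \<open>ball_subset_max_ball\<close> this allows
  gauges given by open neighbourhoods and gauges given by radii to be exchanged.\<close>

lemma max_ball_subset_open:
  fixes U :: "(real ^ 'm) set"
  assumes "open U" "t \<in> U"
  shows "\<exists>r>0. max_ball t r \<subseteq> U"
proof -
  obtain e where e: "e > 0" "ball t e \<subseteq> U"
    using assms by (meson openE)
  define c where "c = sqrt (real DIM(real ^ 'm))"
  have "c > 0"
    by (simp add: c_def)
  have "max_ball t (e / c) \<subseteq> ball t e"
  proof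
    fix s assume "s \<in> max_ball t (e / c)"
    then have "c * infnorm (s - t) < e"
      using \<open>c > 0\<close> by (simp add: max_ball_def field_simps)
    then show "s \<in> ball t e"
      using norm_le_infnorm[of "s - t"] by (simp add: c_def dist_norm norm_minus_commute)
  qed
  then show ?thesis
    using e \<open>c > 0\<close> by (intro exI[of _ "e / c"]) auto
qed

section \<open>Divisions of a bounded open set with a prescribed member\<close>

text \<open>R^m is connected and unbounded. The fact serves to show that a nonempty bounded open set
  is not a finite union of closed boxes.\<close>

lemma clopen_bounded_empty:
  fixes S :: "(real ^ 'm) set"
  assumes "open S" "closed S" "bounded S"
  shows "S = {}"
  using assms clopen[of S] not_bounded_UNIV[where ?'a = "real ^ 'm"] by blast

text \<open>The open set \<open>U - W\<close> is cut into non-overlapping boxes, and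
  \<open>W\<close> is put in front of them. Since (iii) speaks only of members of divisions, this is
  how it reaches an arbitrary interval in \<open>U\<close>.\<close>

lemma division_of_open_containing:
  fixes U :: "(real ^ 'm) set"
  assumes U: "open U" "bounded U" and W: "W \<in> intervals_in U"
  obtains C where "C \<in> divisions_of U" "C 0 = W"
proof -
  define V where "V = U - W"
  have "compact W"
    using W by (auto simp: intervals_in_iff)
  then have "open V"
    using U by (auto simp: V_def compact_imp_closed)
  have "bounded V"
    using U by (auto simp: V_def intro: bounded_subset)
  have "V \<noteq> {}"
  proof
    assume "V = {}"
    then have "W = U"
      using W by (auto simp: V_def intervals_in_iff)
    then have "W = {}"
      using U clopen_bounded_empty compact_imp_closed[OF \<open>compact W\<close>] by blast
    then show False
      using W by (simp add: intervals_in_iff)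
  qed
  obtain a b where ab: "V \<subseteq> cbox a b" 
    using \<open>bounded V\<close> bounded_subset_cbox_symmetric by blast
  have "box a b \<noteq> {}"
    using ab \<open>V \<noteq> {}\<close> \<open>open V\<close> interior_maximal[OF ab \<open>open V\<close>] by auto
  \<comment> \<open>Each box of the covering lemma lies in the gauge set of one of its points in
    \<open>V\<close>. With this gauge it therefore lies in \<open>V\<close>, and the boxes cover
    exactly \<open>V\<close>.\<close>
  have "gauge (\<lambda>x. if x \<in> V then V else UNIV)"
    using \<open>open V\<close> by (simp add: gauge_def)
  from covering_lemma[OF ab \<open>box a b \<noteq> {}\<close> this]
  obtain D where D: "countable D"
      "\<And>K. K \<in> D \<Longrightarrow> interior K \<noteq> {} \<and> (\<exists>c d. K = cbox c d)"
      "pairwise (\<lambda>A B. interior A \<inter> interior B = {}) D"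
      "\<And>K. K \<in> D \<Longrightarrow> \<exists>x\<in>V \<inter> K. K \<subseteq> (if x \<in> V then V else UNIV)"
      "V \<subseteq> \<Union>D"
    by metis
  have sub: "K \<subseteq> V" if "K \<in> D" for K
    using D(4)[OF that] by auto
  then have DV: "\<Union>D = V"
    using D(5) by auto
  \<comment> \<open>A division is indexed by all natural numbers and its members are nondegenerate,
    so it cannot be padded. An infinite \<open>D\<close> can be enumerated without
    repetition.\<close>
  have "infinite D"
  proof
    assume "finite D"
    moreover have "closed K" if "K \<in> D" for K
      using D(2)[OF that] closed_cbox by auto
    ultimately have "closed V"
      unfolding DV[symmetric] by blast
    then show False
      using clopen_bounded_empty \<open>open V\<close> \<open>bounded V\<close> \<open>V \<noteq> {}\<close> by blast
  qed
  then have bij: "bij_betw (from_nat_into D) UNIV D"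
    using D(1) by (intro bij_betw_from_nat_into)
  define C where "C n = (case n of 0 \<Rightarrow> W | Suc k \<Rightarrow> from_nat_into D k)" for n
  have C: "C 0 = W" "\<And>k. C (Suc k) = from_nat_into D k"
    by (simp_all add: C_def)
  have D': "from_nat_into D k \<in> D" for k
    using bij by (auto simp: bij_betw_def)
  have int: "C k \<in> intervals_in U" for k
    using W D(2)[OF D'] sub[OF D'] by (cases k) (auto simp: C intervals_in_iff V_def)
  have UC: "(\<Union>k. C k) = U"
  proof -
    have "(\<Union>k. C k) = W \<union> (\<Union>k. from_nat_into D k)"
    proof (intro equalityI subsetI)
      fix x assume "x \<in> (\<Union>k. C k)"
      then obtain k where "x \<in> C k"
        by blast
      then show "x \<in> W \<union> (\<Union>k. from_nat_into D k)"
        by (cases k) (auto simp: C)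
    next
      fix x assume "x \<in> W \<union> (\<Union>k. from_nat_into D k)"
      then show "x \<in> (\<Union>k. C k)"
        unfolding C[symmetric] by blast
    qed
    also have "\<dots> = W \<union> V"
      using bij DV by (auto simp: bij_betw_def)
    finally show ?thesis
      using W by (auto simp: V_def intervals_in_iff)
  qed
  have W': "interior W \<inter> interior (from_nat_into D k) = {}" for k
    using sub[OF D', of k] interior_subset[of W] interior_subset[of "from_nat_into D k"]
    by (auto simp: V_def)
  have DD: "interior (from_nat_into D j) \<inter> interior (from_nat_into D k) = {}" if "j \<noteq> k" for j k
  proof -
    have "from_nat_into D j \<noteq> from_nat_into D k"
      using bij that by (auto simp: bij_betw_def dest: injD)
    then show ?thesis
      using D(3) D' by (auto simp: pairwise_def)
  qed
  have "interior (C j) \<inter> interior (C k) = {}" if "j \<noteq> k" for j k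
    using that W' DD by (cases j; cases k) (auto simp: C Int_commute)
  then have "C \<in> divisions_of U"
    using int UC by (auto simp: divisions_of_def divisions_in_def non_overlapping_def)
  then show thesis
    using that C by blast
qed

subsection \<open>Henstock sums\<close>

text \<open>The first clause of Dunford-Henstock-Kurzweil integrability, separated from the other
  two so that it can be used both for the interior of \<open>G\<close> and for the whole
  space.\<close>

definition henstock_primitive ::
    "(real ^ 'm) set \<Rightarrow> (real ^ 'm \<Rightarrow> 'a::banach) \<Rightarrow> ((real ^ 'm) set \<Rightarrow> 'a) \<Rightarrow> bool" where
  "henstock_primitive U f F \<longleftrightarrow>
     (\<forall>\<epsilon>>0. \<exists>\<delta>. gauge_fun_on U \<delta> \<and>
       (\<forall>\<pi>. hk_partition_in U \<pi> \<and> fine_partition \<delta> \<pi> \<longrightarrow>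
          norm (\<Sum>(t, I)\<in>\<pi>. measure lebesgue I *\<^sub>R f t - F I) < \<epsilon>))"

lemma hk_partition_in_subset:
  assumes "hk_partition_in U \<pi>" "\<rho> \<subseteq> \<pi>" "\<And>t I. (t, I) \<in> \<rho> \<Longrightarrow> I \<subseteq> W"
  shows "hk_partition_in W \<rho>"
proof -
  have "\<rho> tagged_partial_division_of U"
    using assms by (auto simp: hk_partition_in_def intro: tagged_partial_division_subset)
  then have "\<rho> tagged_partial_division_of W"
    using assms(3) unfolding tagged_partial_division_of_def by blast
  then show ?thesis
    using assms by (auto simp: hk_partition_in_def intervals_in_iff)
qed

text \<open>Henstock's lemma on one interval, with a radius gauge chosen inside the open gauge sets.
  For values in a Banach space it bounds the norm of the whole sum, not the sum of the norms. The
  bound is weak because the partial partition is completed by further intervals whose error is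
  arbitrarily small.\<close>

lemma Henstock_lemma_interval:
  fixes f :: "real ^ 'm \<Rightarrow> 'a::banach"
  assumes W: "W \<in> intervals_in UNIV"
    and F: "\<And>I. I \<in> intervals_in W \<Longrightarrow> (f has_integral F I) I"
    and "\<epsilon> > 0"
  obtains \<delta> where "gauge_fun_on UNIV \<delta>"
    "\<And>\<pi>. hk_partition_in W \<pi> \<Longrightarrow> fine_partition \<delta> \<pi> \<Longrightarrow>
       norm (\<Sum>(t, I)\<in>\<pi>. measure lebesgue I *\<^sub>R f t - F I) \<le> \<epsilon>"
proof -
  obtain a b where ab: "W = cbox a b"
    using W by (auto simp: intervals_in_iff)
  have "W \<in> intervals_in W"
    using W by (auto simp: intervals_in_iff)
  then have "(f has_integral F W) W" and f: "f integrable_on cbox a b"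
    using F ab by (auto simp: integrable_on_def)
  then have "\<exists>\<gamma>. gauge \<gamma> \<and> (\<forall>p. p tagged_division_of cbox a b \<and> \<gamma> fine p \<longrightarrow>
      norm ((\<Sum>(x, K)\<in>p. measure lborel K *\<^sub>R f x) - integral (cbox a b) f) < \<epsilon>)"
    using integrable_integral[OF f] by (simp only: has_integral \<open>\<epsilon> > 0\<close>)
  then obtain \<gamma> where \<gamma>: "gauge \<gamma>" "\<forall>p. p tagged_division_of cbox a b \<and> \<gamma> fine p \<longrightarrow>
      norm ((\<Sum>(x, K)\<in>p. measure lborel K *\<^sub>R f x) - integral (cbox a b) f) < \<epsilon>"
    by (elim exE conjE) (rule that)
  have "\<forall>t. \<exists>r>0. max_ball t r \<subseteq> \<gamma> t"
    using \<gamma>(1) max_ball_subset_open by (auto simp: gauge_def)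
  then obtain \<delta> where \<delta>: "\<And>t. \<delta> t > 0" "\<And>t. max_ball t (\<delta> t) \<subseteq> \<gamma> t"
    by metis
  show thesis
  proof
    show "gauge_fun_on UNIV \<delta>"
      using \<delta> by (simp add: gauge_fun_on_def)
    fix \<pi> assume \<pi>: "hk_partition_in W \<pi>" "fine_partition \<delta> \<pi>"
    have "\<gamma> fine \<pi>"
      using \<pi>(2) \<delta>(2) by (fastforce simp: fine_partition_def fine_def)
    moreover have "\<pi> tagged_partial_division_of cbox a b"
      using \<pi> ab by (simp add: hk_partition_in_def)
    ultimately have "norm (\<Sum>(x, K)\<in>\<pi>. measure lborel K *\<^sub>R f x - integral K f) \<le> \<epsilon>"
      by (intro Henstock_lemma_part1[OF f \<open>\<epsilon> > 0\<close> \<gamma>(1) \<gamma>(2)[rule_format, OF conjI]])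
    also have "(\<Sum>(x, K)\<in>\<pi>. measure lborel K *\<^sub>R f x - integral K f) =
        (\<Sum>(t, I)\<in>\<pi>. measure lebesgue I *\<^sub>R f t - F I)"
    proof (intro sum.cong refl, clarify)
      fix t I assume "(t, I) \<in> \<pi>"
      then have I: "I \<in> intervals_in W"
        using \<pi> by (auto simp: hk_partition_in_def)
      then have "integral I f = F I"
        using F by (blast intro: integral_unique)
      then show "measure lborel I *\<^sub>R f t - integral I f = measure lebesgue I *\<^sub>R f t - F I"
        using I by (auto simp: intervals_in_iff)
    qed
    finally show "norm (\<Sum>(t, I)\<in>\<pi>. measure lebesgue I *\<^sub>R f t - F I) \<le> \<epsilon>" .
  qed
qed

section \<open>Henstock sums over open sets and integrals over intervals\<close>

text \<open>Lindelof's theorem for the interiors of all intervals in \<open>U\<close>. The members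
  may overlap and, if the subcover is finite, repeat.\<close>

lemma countable_interval_cover:
  fixes U :: "(real ^ 'm) set"
  assumes "open U" "U \<noteq> {}"
  obtains W :: "nat \<Rightarrow> (real ^ 'm) set"
  where "\<And>n. W n \<in> intervals_in U" "U = (\<Union>n. interior (W n))"
proof -
  define \<F> where "\<F> = interior ` intervals_in U"
  have "\<Union>\<F> = U"
  proof
    show "\<Union>\<F> \<subseteq> U"
      using interior_subset by (fastforce simp: \<F>_def intervals_in_iff)
    show "U \<subseteq> \<Union>\<F>"
    proof
      fix t assume "t \<in> U"
      then obtain a b where "cbox a b \<subseteq> U" "t \<in> box a b"
        using open_contains_cbox[OF \<open>open U\<close>] by metis
      then show "t \<in> \<Union>\<F>"
        unfolding \<F>_def by (intro UnionI[of "interior (cbox a b)"] imageI) (auto simp: intervals_in_iff)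
    qed
  qed
  obtain \<F>' where \<F>': "\<F>' \<subseteq> \<F>" "countable \<F>'" "\<Union>\<F>' = \<Union>\<F>"
    using Lindelof[of \<F>] by (auto simp: \<F>_def)
  then have "\<F>' \<noteq> {}"
    using \<open>\<Union>\<F> = U\<close> \<open>U \<noteq> {}\<close> by auto
  have "\<exists>W. W \<in> intervals_in U \<and> interior W = from_nat_into \<F>' n" for n
  proof -
    have "from_nat_into \<F>' n \<in> interior ` intervals_in U"
      using from_nat_into[OF \<open>\<F>' \<noteq> {}\<close>, of n] \<F>'(1) unfolding \<F>_def by blast
    then show ?thesis
      by (metis imageE)
  qed
  then obtain W where W: "\<And>n. W n \<in> intervals_in U" "\<And>n. interior (W n) = from_nat_into \<F>' n"
    by metis
  have "(\<Union>n. interior (W n)) = \<Union>(range (from_nat_into \<F>'))"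
    by (simp add: W)
  also have "\<dots> = U"
    using range_from_nat_into[OF \<open>\<F>' \<noteq> {}\<close> \<F>'(2)] \<F>'(3) \<open>\<Union>\<F> = U\<close> by simp
  finally show thesis
    using that[of W] W(1) by blast
qed

lemma sum_geometric_le:
  fixes e :: real
  assumes "finite N" "e \<ge> 0"
  shows "(\<Sum>n\<in>N. e / 2 ^ n) \<le> 2 * e"
proof -
  have "(\<lambda>n. e * (1/2) ^ n) sums (e * (1 / (1 - 1/2)))"
    by (intro sums_mult geometric_sums) simp
  then have s: "(\<lambda>n. e / 2 ^ n) sums (2 * e)"
    by (simp add: power_one_over divide_simps mult_ac)
  show ?thesis
    using sum_le_suminf[OF sums_summable[OF s] assms(1)] sums_unique[OF s] assms(2) by simp
qed

text \<open>Every tag is charged to the first member of a countable cover whose interior contains it,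
  so the cover need not be locally finite.\<close>

lemma henstock_primitive_if_has_integral:
  fixes f :: "real ^ 'm \<Rightarrow> 'a::banach"
  assumes "open U"
    and F: "\<And>I. I \<in> intervals_in U \<Longrightarrow> (f has_integral F I) I"
  shows "henstock_primitive U f F"
  unfolding henstock_primitive_def
proof (intro allI impI)
  fix \<epsilon> :: real assume "\<epsilon> > 0"
  show "\<exists>\<delta>. gauge_fun_on U \<delta> \<and>
       (\<forall>\<pi>. hk_partition_in U \<pi> \<and> fine_partition \<delta> \<pi> \<longrightarrow>
          norm (\<Sum>(t, I)\<in>\<pi>. measure lebesgue I *\<^sub>R f t - F I) < \<epsilon>)"
  proof (cases "U = {}")
    case True
    have "\<pi> = {}" if "hk_partition_in U \<pi>" for \<pi>
      using that True by (auto simp: hk_partition_in_def intervals_in_iff)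
    then have "norm (\<Sum>(t, I)\<in>\<pi>. measure lebesgue I *\<^sub>R f t - F I) < \<epsilon>"
      if "hk_partition_in U \<pi>" for \<pi>
      using that \<open>\<epsilon> > 0\<close> by fastforce
    then show ?thesis
      using True by (auto simp: gauge_fun_on_def)
  next
    case False
    obtain W where W: "\<And>n::nat. W n \<in> intervals_in U" "U = (\<Union>n. interior (W n))"
      using countable_interval_cover[OF \<open>open U\<close> False] by metis
    \<comment> \<open>The errors \<open>\<epsilon> / 4 / 2 ^ n\<close> add up to at most
      \<open>\<epsilon> / 2\<close>, which leaves room for the strict inequality.\<close>
    define good where "good n \<delta> \<longleftrightarrow> gauge_fun_on UNIV \<delta> \<and>
      (\<forall>\<pi>. hk_partition_in (W n) \<pi> \<longrightarrow> fine_partition \<delta> \<pi> \<longrightarrow>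
         norm (\<Sum>(t, I)\<in>\<pi>. measure lebesgue I *\<^sub>R f t - F I) \<le> \<epsilon> / 4 / 2 ^ n)" for n \<delta>
    have "\<exists>\<delta>. good n \<delta>" for n
    proof -
      have *: "W n \<in> intervals_in UNIV" "\<epsilon> / 4 / 2 ^ n > 0"
        using W(1) \<open>\<epsilon> > 0\<close> by (auto intro: intervals_in_mono)
      have **: "(f has_integral F I) I" if "I \<in> intervals_in (W n)" for I
        using F W(1)[of n] that by (auto simp: intervals_in_iff)
      show ?thesis
        unfolding good_def
        by (rule Henstock_lemma_interval[of "W n" f F, OF *(1) ** *(2)]) blast+
    qed
    then obtain \<delta>' where "\<And>n. good n (\<delta>' n)"
      by metis
    then have \<delta>': "\<And>n. gauge_fun_on UNIV (\<delta>' n)"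
      "\<And>n \<pi>. hk_partition_in (W n) \<pi> \<Longrightarrow> fine_partition (\<delta>' n) \<pi> \<Longrightarrow>
         norm (\<Sum>(t, I)\<in>\<pi>. measure lebesgue I *\<^sub>R f t - F I) \<le> \<epsilon> / 4 / 2 ^ n"
      unfolding good_def by blast+
    define N where "N t = (LEAST n. t \<in> interior (W n))" for t
    have N: "t \<in> interior (W (N t))" if "t \<in> U" for t
      unfolding N_def using that W(2) by (metis (no_types, lifting) LeastI_ex UN_iff)
    have "\<exists>r>0. max_ball t r \<subseteq> interior (W (N t))" if "t \<in> U" for t
      using max_ball_subset_open[OF open_interior N[OF that]] .
    then obtain r where r: "\<And>t. t \<in> U \<Longrightarrow> r t > 0"
        "\<And>t. t \<in> U \<Longrightarrow> max_ball t (r t) \<subseteq> interior (W (N t))"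
      by metis
    \<comment> \<open>The radius \<open>r t\<close> keeps an interval tagged at \<open>t\<close>
      inside \<open>W (N t)\<close>. Thus all pairs with the same value of \<open>N\<close> form a
      partition in a single \<open>W n\<close>, fine for its gauge.\<close>
    define \<delta> where "\<delta> t = min (r t) (\<delta>' (N t) t)" for t
    show ?thesis
    proof (intro exI conjI allI impI)
      show "gauge_fun_on U \<delta>"
        using r \<delta>'(1) by (auto simp: gauge_fun_on_def \<delta>_def)
      fix \<pi> assume \<pi>: "hk_partition_in U \<pi> \<and> fine_partition \<delta> \<pi>"
      define \<rho> where "\<rho> n = {(t, I) \<in> \<pi>. N t = n}" for n
      let ?S = "\<lambda>\<pi>. \<Sum>(t, I)\<in>\<pi>. measure lebesgue I *\<^sub>R f t - F I"
      have fin: "finite \<pi>"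
        using \<pi> by (auto simp: hk_partition_in_def dest: tagged_partial_division_ofD(1))
      have tag: "t \<in> U" if "(t, I) \<in> \<pi>" for t I
        using that \<pi> unfolding hk_partition_in_def tagged_partial_division_of_def by blast
      have small: "I \<subseteq> max_ball t (r t)" "I \<subseteq> max_ball t (\<delta>' (N t) t)" if "(t, I) \<in> \<pi>" for t I
        using that \<pi> by (fastforce simp: fine_partition_def max_ball_def \<delta>_def)+
      have "norm (?S (\<rho> n)) \<le> \<epsilon> / 4 / 2 ^ n" for n
      proof (rule \<delta>'(2))
        show "hk_partition_in (W n) (\<rho> n)"
        proof (rule hk_partition_in_subset)
          show "hk_partition_in U \<pi>" "\<rho> n \<subseteq> \<pi>"
            using \<pi> by (auto simp: \<rho>_def)
          show "I \<subseteq> W n" if "(t, I) \<in> \<rho> n" for t I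
            using that small(1)[of t I] r(2)[of t] tag[of t I] interior_subset[of "W n"]
            by (auto simp: \<rho>_def)
        qed
        show "fine_partition (\<delta>' n) (\<rho> n)"
          using small(2) by (fastforce simp: fine_partition_def \<rho>_def)
      qed
      moreover have "?S \<pi> = (\<Sum>n\<in>(N \<circ> fst) ` \<pi>. ?S {x \<in> \<pi>. (N \<circ> fst) x = n})"
        by (rule sum.image_gen[OF fin])
      moreover have "{x \<in> \<pi>. (N \<circ> fst) x = n} = \<rho> n" for n
        by (auto simp: \<rho>_def)
      ultimately have "norm (?S \<pi>) \<le> (\<Sum>n\<in>(N \<circ> fst) ` \<pi>. \<epsilon> / 4 / 2 ^ n)"
        by (auto intro!: sum_norm_le)
      also have "\<dots> \<le> 2 * (\<epsilon> / 4)"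
        using fin \<open>\<epsilon> > 0\<close> by (intro sum_geometric_le) auto
      finally show "norm (?S \<pi>) < \<epsilon>"
        using \<open>\<epsilon> > 0\<close> by simp
    qed
  qed
qed

text \<open>An \<open>operative\<close> interval function is additive under hyperplane cuts and zero
  on degenerate boxes, so its values over a tagged division of \<open>W\<close> add up to
  \<open>\<Phi> W\<close>. The Henstock sum is then the Riemann sum minus
  \<open>\<Phi> W\<close>.\<close>

lemma has_integral_if_henstock_primitive:
  fixes f :: "real ^ 'm \<Rightarrow> 'a::banach"
  assumes \<Phi>: "operative plus 0 \<Phi>"
    and h: "henstock_primitive U f \<Phi>"
    and W: "W \<in> intervals_in U"
  shows "(f has_integral \<Phi> W) W"
proof -
  interpret operative plus 0 \<Phi>
    by (rule \<Phi>)
  obtain a b where ab: "W = cbox a b"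
    using W by (auto simp: intervals_in_iff)
  show ?thesis
    unfolding ab has_integral
  proof (intro allI impI)
    fix \<epsilon> :: real assume "\<epsilon> > 0"
    then obtain \<delta> where \<delta>: "gauge_fun_on U \<delta>"
      "\<And>\<pi>. hk_partition_in U \<pi> \<Longrightarrow> fine_partition \<delta> \<pi> \<Longrightarrow>
         norm (\<Sum>(t, I)\<in>\<pi>. measure lebesgue I *\<^sub>R f t - \<Phi> I) < \<epsilon>"
      using h[unfolded henstock_primitive_def, rule_format, OF \<open>\<epsilon> > 0\<close>] by blast
    \<comment> \<open>The radius 1 outside \<open>U\<close> is a mere default: all tags lie in
      \<open>W\<close>, hence in \<open>U\<close>.\<close>
    define \<gamma> where "\<gamma> t = ball t (if t \<in> U then \<delta> t else 1)" for t
    have "gauge \<gamma>"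
      using \<delta>(1) by (auto simp: gauge_def \<gamma>_def gauge_fun_on_def)
    have fine_sum: "norm ((\<Sum>(x, k)\<in>p. measure lborel k *\<^sub>R f x) - \<Phi> (cbox a b)) < \<epsilon>"
      if p: "p tagged_division_of cbox a b" "\<gamma> fine p" for p
    proof -
      \<comment> \<open>Divisions in the sense of the library may contain degenerate boxes. Their
        content and their value under \<open>\<Phi>\<close> are zero, so discarding them does not
        change the sum.\<close>
      define \<pi> where "\<pi> = {(t, I) \<in> p. interior I \<noteq> {}}"
      note p' = tagged_division_ofD[OF p(1)]
      have "W \<subseteq> U"
        using W by (simp add: intervals_in_iff)
      have "\<pi> tagged_partial_division_of cbox a b"
        using p(1) by (rule tagged_partial_division_subset[OF tagged_division_of_def[THEN iffD1, THEN conjunct1]])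
          (auto simp: \<pi>_def)
      then have "\<pi> tagged_partial_division_of U"
        using \<open>W \<subseteq> U\<close> unfolding tagged_partial_division_of_def ab by blast
      moreover have int: "I \<in> intervals_in U" if "(t, I) \<in> \<pi>" for t I
        using that p'(3,4) W unfolding \<pi>_def ab intervals_in_iff by blast
      ultimately have "hk_partition_in U \<pi>"
        by (auto simp: hk_partition_in_def)
      moreover have "fine_partition \<delta> \<pi>"
        unfolding fine_partition_def
      proof clarify
        fix t I s assume *: "(t, I) \<in> \<pi>" "s \<in> I"
        then have "t \<in> U" "s \<in> \<gamma> t"
          using p'(2)[of t I] p(2) int[OF *(1)] by (auto simp: fine_def \<pi>_def intervals_in_iff)
        then show "s \<in> max_ball t (\<delta> t)"
          using ball_subset_max_ball[of t "\<delta> t"] by (auto simp: \<gamma>_def)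
      qed
      ultimately have "norm (\<Sum>(t, I)\<in>\<pi>. measure lebesgue I *\<^sub>R f t - \<Phi> I) < \<epsilon>"
        by (rule \<delta>(2))
      also have "(\<Sum>(t, I)\<in>\<pi>. measure lebesgue I *\<^sub>R f t - \<Phi> I) =
          (\<Sum>(t, I)\<in>p. measure lborel I *\<^sub>R f t - \<Phi> I)"
      proof (rule sum.mono_neutral_cong_left)
        show "finite p" "\<pi> \<subseteq> p"
          using p' by (auto simp: \<pi>_def)
        show "\<forall>i\<in>p - \<pi>. (case i of (t, I) \<Rightarrow> measure lborel I *\<^sub>R f t - \<Phi> I) = 0"
        proof (clarify)
          fix t I assume "(t, I) \<in> p" "(t, I) \<notin> \<pi>"
          then obtain c d where "I = cbox c d" "interior I = {}"
            using p'(4) unfolding \<pi>_def by blast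
          then show "measure lborel I *\<^sub>R f t - \<Phi> I = 0"
            using box_empty_imp[of c d] content_eq_0_interior[of c d] by simp
        qed
        show "(case x of (t, I) \<Rightarrow> measure lebesgue I *\<^sub>R f t - \<Phi> I) =
            (case x of (t, I) \<Rightarrow> measure lborel I *\<^sub>R f t - \<Phi> I)" if "x \<in> \<pi>" for x
        proof -
          obtain t I where x: "x = (t, I)"
            by force
          then show ?thesis
            using int[of t I] that by (auto simp: intervals_in_iff)
        qed
      qed
      also have "\<dots> = (\<Sum>(t, I)\<in>p. measure lborel I *\<^sub>R f t) - (\<Sum>(t, I)\<in>p. \<Phi> I)"
        by (simp add: case_prod_unfold sum_subtractf)
      also have "(\<Sum>(t, I)\<in>p. \<Phi> I) = \<Phi> (cbox a b)"
        using tagged_division[OF p(1)] unfolding sum_def .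
      finally show ?thesis .
    qed
    show "\<exists>\<gamma>. gauge \<gamma> \<and> (\<forall>\<D>. \<D> tagged_division_of cbox a b \<and> \<gamma> fine \<D> \<longrightarrow>
        norm ((\<Sum>(x, k)\<in>\<D>. measure lborel k *\<^sub>R f x) - \<Phi> (cbox a b)) < \<epsilon>)"
      by (intro exI[of _ \<gamma>] conjI allI impI \<open>gauge \<gamma>\<close> fine_sum) (elim conjE, assumption)+
  qed
qed

subsection \<open>Extension of a Dunford-function\<close>

text \<open>The values of \<open>F\<close> on degenerate boxes are arbitrary. Replacing them by zero
  lets the series run over all indices instead of \<open>meeting_indices\<close> and makes
  additivity hold for every hyperplane cut.\<close>

definition nondeg :: "((real ^ 'm) set \<Rightarrow> 'a::zero) \<Rightarrow> (real ^ 'm) set \<Rightarrow> 'a" where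
  "nondeg F I = (if interior I = {} then 0 else F I)"

text \<open>The value makes sense for every interval, contained in the domain of \<open>F\<close> or
  not. Since \<open>infsum\<close> is zero for a series that does not converge, convergence is
  recorded separately by \<open>has_sum\<close>.\<close>

definition extension ::
    "((real ^ 'm) set \<Rightarrow> 'a::banach) \<Rightarrow> (nat \<Rightarrow> (real ^ 'm) set) \<Rightarrow> (real ^ 'm) set \<Rightarrow> 'a" where
  "extension F C I = (\<Sum>\<^sub>\<infinity>k. nondeg F (I \<inter> C k))"

lemma nondeg_subset: "interior I = {} \<Longrightarrow> J \<subseteq> I \<Longrightarrow> nondeg F J = 0"
  using interior_mono[of J I] by (simp add: nondeg_def)

lemma divisions_of_interior: "C \<in> divisions_of (interior E) \<Longrightarrow> C \<in> divisions_in E"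
  unfolding divisions_of_def divisions_in_def
  by (blast intro: intervals_in_mono[OF _ interior_subset])

lemma division_interval: "C \<in> divisions_in E \<Longrightarrow> C k \<in> intervals_in E"
  by (simp add: divisions_in_def)

text \<open>The intersection of two boxes is a box, and a box has content zero exactly when its
  interior is empty.\<close>

lemma mem_meeting_indices_iff:
  assumes "I \<in> intervals_in UNIV" "C \<in> divisions_in E"
  shows "k \<in> meeting_indices I C \<longleftrightarrow> interior (I \<inter> C k) \<noteq> {}"
proof -
  obtain a b where I: "I = cbox a b"
    using assms(1) by (auto simp: intervals_in_iff)
  obtain c d where C: "C k = cbox c d"
    using division_interval[OF assms(2), of k] by (auto simp: intervals_in_iff)
  obtain u v where uv: "I \<inter> C k = cbox u v"
    using that by (simp only: I C Int_interval)
  have "measure lebesgue (I \<inter> C k) = measure lborel (cbox u v)"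
    by (simp add: uv)
  then have "measure lebesgue (I \<inter> C k) = 0 \<longleftrightarrow> interior (I \<inter> C k) = {}"
    by (simp only: uv content_eq_0_interior)
  then show ?thesis
    using measure_nonneg[of lebesgue "I \<inter> C k"] by (auto simp: meeting_indices_def less_le)
qed

lemma has_sum_meeting_indices_iff:
  assumes "I \<in> intervals_in UNIV" "C \<in> divisions_in E"
  shows "((\<lambda>k. F (I \<inter> C k)) has_sum s) (meeting_indices I C) \<longleftrightarrow>
    ((\<lambda>k. nondeg F (I \<inter> C k)) has_sum s) UNIV"
  using mem_meeting_indices_iff[OF assms] by (intro has_sum_cong_neutral) (auto simp: nondeg_def)

lemma infsum_meeting_indices:
  assumes "I \<in> intervals_in UNIV" "C \<in> divisions_in E"
  shows "(\<Sum>\<^sub>\<infinity>k\<in>meeting_indices I C. F (I \<inter> C k)) = extension F C I"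
  unfolding extension_def
  using mem_meeting_indices_iff[OF assms] by (intro infsum_cong_neutral) (auto simp: nondeg_def)

lemma dunford_function_has_sum_extension:
  assumes "dunford_function E F" "C \<in> divisions_in E" "I \<in> intervals_in UNIV"
  shows "((\<lambda>k. nondeg F (I \<inter> C k)) has_sum extension F C I) UNIV"
proof -
  have "(\<lambda>k. F (I \<inter> C k)) summable_on meeting_indices I C"
    using assms by (simp add: dunford_function_def)
  then show ?thesis
    using has_sum_meeting_indices_iff[OF assms(3,2)] infsum_meeting_indices[OF assms(3,2)]
    by (metis has_sum_infsum)
qed

text \<open>For a nondegenerate box this is condition (b) of a Dunford-function; for a degenerate
  one all terms vanish. Degenerate boxes are included because the lemma is applied to traces of
  intervals.\<close>

lemma extension_eq_nondeg:
  assumes "dunford_function E F" "C \<in> divisions_of (interior E)" "J = cbox a b" "J \<subseteq> E"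
  shows "extension F C J = nondeg F J"
proof (cases "interior J = {}")
  case True
  have "nondeg F (J \<inter> C k) = 0" for k
    using True by (rule nondeg_subset) simp
  then show ?thesis
    using True by (simp add: extension_def nondeg_def)
next
  case False
  then have J: "J \<in> intervals_in E"
    using assms by (auto simp: intervals_in_iff)
  have C: "C \<in> divisions_in E"
    using assms(2) by (rule divisions_of_interior)
  have "((\<lambda>k. F (J \<inter> C k)) has_sum F J) (meeting_indices J C)"
    using assms(1,2) J C by (simp add: dunford_function_def)
  then show ?thesis
    using infsum_meeting_indices[OF intervals_in_mono[OF J subset_UNIV] C, of F] False
    by (simp add: infsumI nondeg_def)
qed

lemma extension_eq:
  assumes "dunford_function E F" "C \<in> divisions_of (interior E)" "I \<in> intervals_in E"
  shows "extension F C I = F I"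
proof -
  obtain a b where "I = cbox a b" "I \<subseteq> E" "interior I \<noteq> {}"
    using assms(3) unfolding intervals_in_iff by blast
  then show ?thesis
    using extension_eq_nondeg[OF assms(1,2)] by (simp add: nondeg_def)
qed

section \<open>Additivity of the extension and its independence of the division\<close>

text \<open>If both halves are nondegenerate, this is the additivity of \<open>F\<close>. If one
  half of a nondegenerate box is degenerate, the other half is the whole box.\<close>

lemma nondeg_split:
  assumes "additive_interval_function E F" "J = cbox a b" "J \<subseteq> E" "i \<in> Basis"
  shows "nondeg F J = nondeg F (J \<inter> {x. x \<bullet> i \<le> c}) + nondeg F (J \<inter> {x. x \<bullet> i \<ge> c})"
proof -
  define L R where "L = J \<inter> {x. x \<bullet> i \<le> c}" and "R = J \<inter> {x. x \<bullet> i \<ge> c}"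
  have LR: "L \<union> R = J"
    by (auto simp: L_def R_def)
  have box: "\<exists>a b. L = cbox a b" "\<exists>a b. R = cbox a b"
    by (simp_all only: L_def R_def assms(2) interval_split[OF assms(4)]) blast+
  have closed: "closed L" "closed R"
    using box by auto
  \<comment> \<open>The open set \<open>interior J - B\<close> is contained in \<open>A\<close> and
    hence empty. So \<open>B\<close> contains the interior of \<open>J\<close>, and with it the
    closure of that interior, which is \<open>J\<close>.\<close>
  have absorb: "J = B" if B: "closed B" and AB: "A \<union> B = J" and A: "interior A = {}"
    and J: "interior J \<noteq> {}" for A B
  proof -
    have "interior J - B \<subseteq> interior A"
      using AB interior_subset[of J] B by (intro interior_maximal) auto
    then have "closure (interior J) \<subseteq> B"
      using A B by (intro closure_minimal) auto
    moreover have "closure (interior J) = J"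
      using J by (simp add: assms(2) closure_box)
    ultimately show ?thesis
      using AB by blast
  qed
  consider "interior J = {}" | "interior J \<noteq> {}" "interior L = {}"
    | "interior J \<noteq> {}" "interior R = {}" | "interior L \<noteq> {}" "interior R \<noteq> {}"
    by blast
  then have "nondeg F J = nondeg F L + nondeg F R"
  proof cases
    case 1
    have "nondeg F L = 0" "nondeg F R = 0" "nondeg F J = 0"
      using LR by (auto intro!: nondeg_subset[OF 1])
    then show ?thesis
      by simp
  next
    case 2
    then show ?thesis
      using absorb[OF closed(2) LR] by (simp add: nondeg_def)
  next
    case 3
    then show ?thesis
      using absorb[OF closed(1), of R] LR by (simp add: nondeg_def Un_commute)
  next
    case 4
    have "interior J \<noteq> {}"
      using 4 interior_mono[of L J] LR by blast
    have "L \<in> intervals_in E" "R \<in> intervals_in E" "J \<in> intervals_in E"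
      using 4 \<open>interior J \<noteq> {}\<close> box assms(2,3) LR by (auto simp: intervals_in_iff)
    moreover have "non_overlapping L R"
    proof -
      have "interior L \<inter> interior R \<subseteq> interior {x. x \<bullet> i = c}"
        unfolding interior_Int[symmetric] by (rule interior_mono) (auto simp: L_def R_def)
      then show ?thesis
        using assms(4) interior_hyperplane[of i c]
        by (auto simp: non_overlapping_def inner_commute nonzero_Basis)
    qed
    ultimately have "F (L \<union> R) = F L + F R"
      using assms(1) LR unfolding additive_interval_function_def by auto
    then show ?thesis
      using 4 \<open>interior J \<noteq> {}\<close> LR by (simp add: nondeg_def)
  qed
  then show ?thesis
    by (simp add: L_def R_def)
qed

text \<open>A hyperplane cuts every term into two by \<open>nondeg_split\<close>. Both resulting
  series converge by condition (a), and sums are unique.\<close>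

lemma operative_extension:
  fixes F :: "(real ^ 'm) set \<Rightarrow> 'a::banach"
  assumes F: "dunford_function E F" and C: "C \<in> divisions_in E"
  shows "operative plus 0 (extension F C)"
proof
  fix a b :: "real ^ 'm"
  assume "box a b = {}"
  then have "nondeg F (cbox a b \<inter> C k) = 0" for k
    by (intro nondeg_subset[of "cbox a b"]) auto
  then show "extension F C (cbox a b) = 0"
    by (simp add: extension_def)
next
  fix a b i :: "real ^ 'm" and c :: real
  assume i: "i \<in> Basis"
  let ?I = "cbox a b" and ?L = "{x. x \<bullet> i \<le> c}" and ?R = "{x. x \<bullet> i \<ge> c}"
  have nd: "nondeg F (?I \<inter> C k) = nondeg F (?I \<inter> ?L \<inter> C k) + nondeg F (?I \<inter> ?R \<inter> C k)" for k
  proof -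
    obtain u v where uv: "C k = cbox u v" "C k \<subseteq> E"
      using division_interval[OF C, of k] by (auto simp: intervals_in_iff)
    obtain p q where pq: "?I \<inter> C k = cbox p q"
      using that by (simp only: uv(1) Int_interval)
    have "nondeg F (?I \<inter> C k) =
        nondeg F (?I \<inter> C k \<inter> ?L) + nondeg F (?I \<inter> C k \<inter> ?R)"
      using F uv(2) by (intro nondeg_split[OF _ pq _ i, where E = E]) (auto simp: dunford_function_def)
    then show ?thesis
      by (simp only: Int_assoc Int_commute[of "C k"])
  qed
  have sum: "((\<lambda>k. nondeg F (J \<inter> C k)) has_sum extension F C J) UNIV" if "J = cbox u v" for J u v
  proof (cases "interior J = {}")
    case True
    then have "nondeg F (J \<inter> C k) = 0" for k
      by (intro nondeg_subset[of J]) auto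
    then show ?thesis
      by (simp add: extension_def)
  next
    case False
    then have "J \<in> intervals_in UNIV"
      using that by (auto simp: intervals_in_iff)
    then show ?thesis
      by (rule dunford_function_has_sum_extension[OF F C])
  qed
  have "((\<lambda>k. nondeg F (?I \<inter> C k)) has_sum
      extension F C (?I \<inter> ?L) + extension F C (?I \<inter> ?R)) UNIV"
    unfolding nd
    by (rule has_sum_add[OF sum[OF interval_split(1)[OF i]] sum[OF interval_split(2)[OF i]]])
  then show "extension F C ?I = extension F C (?I \<inter> ?L) + extension F C (?I \<inter> ?R)"
    using sum[OF refl] by (blast intro: has_sum_unique)
qed

text \<open>The nondegenerate intersections of the members of two divisions of the interior need not
  cover the interior, but they form a division in \<open>E\<close>; hence the double series converges
  unconditionally and the order of summation may be exchanged.\<close>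

lemma extension_independent:
  assumes F: "dunford_function E F" and I: "I \<in> intervals_in UNIV"
    and C: "C \<in> divisions_of (interior E)" and D: "D \<in> divisions_of (interior E)"
  shows "extension F C I = extension F D I"
proof -
  have C': "C \<in> divisions_in E" and D': "D \<in> divisions_in E"
    using C D divisions_of_interior by blast+
  have UD: "(\<Union>l. D l) = interior E" and UC: "(\<Union>k. C k) = interior E"
    using C D by (auto simp: divisions_of_def)
  define M where "M = {(k, l). interior (C k \<inter> D l) \<noteq> {}}"
  \<comment> \<open>Otherwise \<open>C k\<close> would be a countable union of null sets
    \<open>C k \<inter> D l\<close>. So every \<open>k\<close> occurs in \<open>M\<close>, which is
    therefore infinite and can be enumerated as a division.\<close>
  have "\<exists>l. (k, l) \<in> M" for k
  proof (rule ccontr)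
    assume "\<nexists>l. (k, l) \<in> M"
    then have "interior (C k \<inter> D l) = {}" for l
      by (auto simp: M_def)
    then have "negligible (C k \<inter> D l)" for l
      using negligible_Int_intervals[OF division_interval[OF C'] division_interval[OF D']] by simp
    then have "negligible (\<Union>l. C k \<inter> D l)"
      by (rule negligible_Union_nat)
    also have "(\<Union>l. C k \<inter> D l) = C k \<inter> C k"
      using UC UD by blast
    finally have "interior (C k) = {}"
      using negligible_Int_intervals[OF division_interval[OF C'] division_interval[OF C'], of k k]
      by simp
    then show False
      using division_interval[OF C', of k] by (simp add: intervals_in_iff)
  qed
  then have "fst ` M = UNIV"
    by force
  then have "infinite M"
    by (metis finite_imageI infinite_UNIV_nat)
  then have e: "bij_betw (from_nat_into M) UNIV M"
    by (intro bij_betw_from_nat_into) auto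
  define B where "B = (\<lambda>(k, l). C k \<inter> D l)"
  have "(\<lambda>n. B (from_nat_into M n)) \<in> divisions_in E"
    unfolding divisions_in_def
  proof (safe)
    fix n
    have "from_nat_into M n \<in> M"
      using e by (auto simp: bij_betw_def)
    then obtain k l where kl: "from_nat_into M n = (k, l)" "interior (C k \<inter> D l) \<noteq> {}"
      by (auto simp: M_def)
    show "B (from_nat_into M n) \<in> intervals_in E"
      using intervals_in_Int[OF division_interval[OF C'] division_interval[OF D'] kl(2)]
      by (simp add: B_def kl(1))
  next
    fix n m :: nat
    assume "n \<noteq> m"
    then have ne: "from_nat_into M n \<noteq> from_nat_into M m"
      using e by (auto simp: bij_betw_def dest: injD)
    obtain k l k' l' where kl: "from_nat_into M n = (k, l)" "from_nat_into M m = (k', l')"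
      by fastforce
    have "interior (C k) \<inter> interior (C k') = {} \<or> interior (D l) \<inter> interior (D l') = {}"
    proof (cases "k = k'")
      case True
      then have "l \<noteq> l'"
        using ne by (simp add: kl)
      then show ?thesis
        using D' by (simp add: divisions_in_def non_overlapping_def)
    next
      case False
      then show ?thesis
        using C' by (simp add: divisions_in_def non_overlapping_def)
    qed
    then show "non_overlapping (B (from_nat_into M n)) (B (from_nat_into M m))"
      by (auto simp: kl B_def non_overlapping_def)
  qed
  from dunford_function_has_sum_extension[OF F this I]
  have "(\<lambda>n. nondeg F (I \<inter> B (from_nat_into M n))) summable_on UNIV"
    by (rule has_sum_imp_summable)
  then have "(\<lambda>x. nondeg F (I \<inter> B x)) summable_on M"
    using summable_on_reindex_bij_betw[OF e, of "\<lambda>x. nondeg F (I \<inter> B x)"] by simp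
  \<comment> \<open>Pairs outside \<open>M\<close> contribute zero, so the family is summable over
    all pairs and the iterated sums may be exchanged.\<close>
  also have "?this \<longleftrightarrow> (\<lambda>x. nondeg F (I \<inter> B x)) summable_on UNIV \<times> UNIV"
  proof (rule summable_on_cong_neutral)
    fix x assume "x \<in> UNIV \<times> UNIV - M"
    then have "interior (B x) = {}"
      by (auto simp: M_def B_def)
    then show "nondeg F (I \<inter> B x) = 0"
      by (rule nondeg_subset) simp
  qed simp_all
  also have "(\<lambda>x. nondeg F (I \<inter> B x)) = (\<lambda>(k, l). nondeg F (I \<inter> (C k \<inter> D l)))"
    by (auto simp: B_def)
  finally have *: "(\<Sum>\<^sub>\<infinity>k. \<Sum>\<^sub>\<infinity>l. nondeg F (I \<inter> (C k \<inter> D l))) =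
      (\<Sum>\<^sub>\<infinity>l. \<Sum>\<^sub>\<infinity>k. nondeg F (I \<inter> (C k \<inter> D l)))"
    by (rule infsum_swap_banach)
  \<comment> \<open>Condition (b), applied to the trace \<open>I \<inter> A k\<close>, collapses the
    inner series. It is used once for each order of the two divisions.\<close>
  have inner: "(\<Sum>\<^sub>\<infinity>l. nondeg F (I \<inter> A k \<inter> A' l)) = nondeg F (I \<inter> A k)"
    if A: "A \<in> divisions_in E" and A': "A' \<in> divisions_of (interior E)" for A A' k
  proof -
    obtain a b where ab: "I = cbox a b"
      using I by (auto simp: intervals_in_iff)
    obtain u v where uv: "A k = cbox u v" "A k \<subseteq> E"
      using division_interval[OF A, of k] by (auto simp: intervals_in_iff)
    obtain p q where pq: "I \<inter> A k = cbox p q"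
      using that by (simp only: ab uv(1) Int_interval)
    show ?thesis
      using extension_eq_nondeg[OF F A' pq] uv(2) unfolding extension_def by blast
  qed
  have "(\<Sum>\<^sub>\<infinity>l. nondeg F (I \<inter> (C k \<inter> D l))) = nondeg F (I \<inter> C k)" for k
    using inner[OF C' D, of k] by (simp only: Int_assoc)
  moreover have "(\<Sum>\<^sub>\<infinity>k. nondeg F (I \<inter> (C k \<inter> D l))) = nondeg F (I \<inter> D l)" for l
    using inner[OF D' C, of l] by (simp only: Int_assoc Int_commute[of "D l"])
  ultimately show ?thesis
    using * by (simp add: extension_def)
qed

subsection \<open>The equivalences\<close>

text \<open>From left to right the gauge is restricted to either set of tags; from right to left two
  gauges are glued.\<close>

lemma henstock_primitive_UNIV_iff:
  fixes f :: "real ^ 'm \<Rightarrow> 'a::banach"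
  assumes F: "dunford_function G F" and C: "C \<in> divisions_of (interior G)"
  shows "henstock_primitive UNIV (\<lambda>t. if t \<in> interior G then f t else 0) (extension F C) \<longleftrightarrow>
    henstock_primitive (interior G) f F \<and> hk_negligible_variation_outside_interior G F"
    (is "henstock_primitive UNIV ?f ?\<Phi> \<longleftrightarrow> _")
proof -
  have \<Phi>_eq: "?\<Phi> I = F I" if "I \<in> intervals_in (interior G)" for I
    using extension_eq[OF F C] that intervals_in_mono[OF _ interior_subset] by blast
  have interval: "I \<in> intervals_in E" if "hk_partition_in E \<pi>" "(t, I) \<in> \<pi>" for E \<pi> t I
    using that unfolding hk_partition_in_def by blast
  let ?S = "\<lambda>\<pi>. \<Sum>(t, I)\<in>\<pi>. measure lebesgue I *\<^sub>R ?f t - ?\<Phi> I"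
  have S_inside: "?S \<pi> = (\<Sum>(t, I)\<in>\<pi>. measure lebesgue I *\<^sub>R f t - F I)"
    if \<pi>: "hk_partition_in (interior G) \<pi>" for \<pi>
  proof (intro sum.cong refl, clarify)
    fix t I assume tI: "(t, I) \<in> \<pi>"
    then have "t \<in> I"
      using \<pi> unfolding hk_partition_in_def tagged_partial_division_of_def by blast
    moreover have "I \<subseteq> interior G"
      using interval[OF \<pi> tI] by (simp add: intervals_in_iff)
    ultimately show "measure lebesgue I *\<^sub>R ?f t - ?\<Phi> I = measure lebesgue I *\<^sub>R f t - F I"
      using \<Phi>_eq[OF interval[OF \<pi> tI]] by auto
  qed
  \<comment> \<open>At these tags the function vanishes. Negligible variation asks for one gauge
    that serves all divisions \<open>D\<close>; as the extension does not depend on the division,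
    every \<open>D\<close> gives the same sum as \<open>C\<close>.\<close>
  have S_outside: "?S \<pi> = - (\<Sum>(t, I)\<in>\<pi>. \<Sum>\<^sub>\<infinity>k\<in>meeting_indices I D. F (I \<inter> D k))"
    if \<pi>: "hk_partition_in UNIV \<pi>" and t: "fst ` \<pi> \<subseteq> UNIV - interior G"
      and D: "D \<in> divisions_of (interior G)" for \<pi> D
    unfolding sum_negf[symmetric]
  proof (intro sum.cong refl, clarify)
    fix t I assume tI: "(t, I) \<in> \<pi>"
    have "t \<notin> interior G"
      using t tI by force
    moreover have "(\<Sum>\<^sub>\<infinity>k\<in>meeting_indices I D. F (I \<inter> D k)) = ?\<Phi> I"
      using infsum_meeting_indices[OF interval[OF \<pi> tI] divisions_of_interior[OF D]]
        extension_independent[OF F interval[OF \<pi> tI] C D] by simp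
    ultimately show "measure lebesgue I *\<^sub>R ?f t - ?\<Phi> I =
        - (\<Sum>\<^sub>\<infinity>k\<in>meeting_indices I D. F (I \<inter> D k))"
      by simp
  qed
  show ?thesis
  proof
    assume H: "henstock_primitive UNIV ?f ?\<Phi>"
    have "henstock_primitive (interior G) f F"
      unfolding henstock_primitive_def
    proof (intro allI impI)
      fix \<epsilon> :: real assume "\<epsilon> > 0"
      then obtain \<delta> where \<delta>: "gauge_fun_on UNIV \<delta>"
        "\<And>\<pi>. hk_partition_in UNIV \<pi> \<and> fine_partition \<delta> \<pi> \<Longrightarrow> norm (?S \<pi>) < \<epsilon>"
        using H[unfolded henstock_primitive_def, rule_format, OF \<open>\<epsilon> > 0\<close>] by blast
      show "\<exists>\<delta>. gauge_fun_on (interior G) \<delta> \<and>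
          (\<forall>\<pi>. hk_partition_in (interior G) \<pi> \<and> fine_partition \<delta> \<pi> \<longrightarrow>
            norm (\<Sum>(t, I)\<in>\<pi>. measure lebesgue I *\<^sub>R f t - F I) < \<epsilon>)"
      proof (intro exI[of _ \<delta>] conjI allI impI)
        show "gauge_fun_on (interior G) \<delta>"
          using \<delta>(1) by (simp add: gauge_fun_on_def)
        fix \<pi> assume \<pi>: "hk_partition_in (interior G) \<pi> \<and> fine_partition \<delta> \<pi>"
        then have "hk_partition_in UNIV \<pi>"
          by (auto intro: hk_partition_in_subset)
        then have "norm (?S \<pi>) < \<epsilon>"
          using \<pi> by (intro \<delta>(2)) simp
        then show "norm (\<Sum>(t, I)\<in>\<pi>. measure lebesgue I *\<^sub>R f t - F I) < \<epsilon>"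
          using S_inside \<pi> by simp
      qed
    qed
    moreover have "hk_negligible_variation_over G F (UNIV - interior G)"
      unfolding hk_negligible_variation_over_def
    proof (intro conjI allI impI)
      show "additive_interval_function G F"
        using F by (simp add: dunford_function_def)
      fix \<epsilon> :: real assume "\<epsilon> > 0"
      then obtain \<delta> where \<delta>: "gauge_fun_on UNIV \<delta>"
        "\<And>\<pi>. hk_partition_in UNIV \<pi> \<and> fine_partition \<delta> \<pi> \<Longrightarrow> norm (?S \<pi>) < \<epsilon>"
        using H[unfolded henstock_primitive_def, rule_format, OF \<open>\<epsilon> > 0\<close>] by blast
      show "\<exists>\<delta>. gauge_fun_on (UNIV - interior G) \<delta> \<and>
          (\<forall>\<pi>. hk_partition_in UNIV \<pi> \<and> fst ` \<pi> \<subseteq> UNIV - interior G \<and> fine_partition \<delta> \<pi> \<longrightarrow>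
            (\<forall>D\<in>divisions_of (interior G).
              (\<forall>(t, I)\<in>\<pi>. (\<lambda>k. F (I \<inter> D k)) summable_on meeting_indices I D) \<and>
              norm (\<Sum>(t, I)\<in>\<pi>. \<Sum>\<^sub>\<infinity>k\<in>meeting_indices I D. F (I \<inter> D k)) < \<epsilon>))"
      proof (intro exI[of _ \<delta>] conjI allI impI ballI)
        show "gauge_fun_on (UNIV - interior G) \<delta>"
          using \<delta>(1) by (simp add: gauge_fun_on_def)
        fix \<pi> D
        assume \<pi>: "hk_partition_in UNIV \<pi> \<and> fst ` \<pi> \<subseteq> UNIV - interior G \<and> fine_partition \<delta> \<pi>"
          and D: "D \<in> divisions_of (interior G)"
        show "case x of (t, I) \<Rightarrow> (\<lambda>k. F (I \<inter> D k)) summable_on meeting_indices I D"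
          if "x \<in> \<pi>" for x
        proof -
          obtain t I where x: "x = (t, I)"
            by force
          then have "I \<in> intervals_in UNIV"
            using interval \<pi> that by blast
          then show ?thesis
            using F divisions_of_interior[OF D] by (simp add: dunford_function_def x)
        qed
        have "norm (?S \<pi>) < \<epsilon>"
          using \<pi> by (intro \<delta>(2)) simp
        then show "norm (\<Sum>(t, I)\<in>\<pi>. \<Sum>\<^sub>\<infinity>k\<in>meeting_indices I D. F (I \<inter> D k)) < \<epsilon>"
          using S_outside[OF _ _ D, of \<pi>] \<pi> by simp
      qed
    qed
    ultimately show "henstock_primitive (interior G) f F \<and>
        hk_negligible_variation_outside_interior G F"
      by (simp add: hk_negligible_variation_outside_interior_def)
  next
    assume *: "henstock_primitive (interior G) f F \<and> hk_negligible_variation_outside_interior G F"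
    show "henstock_primitive UNIV ?f ?\<Phi>"
      unfolding henstock_primitive_def
    proof (intro allI impI)
      fix \<epsilon> :: real assume "\<epsilon> > 0"
      then have e2: "\<epsilon> / 2 > 0"
        by simp
      obtain \<delta>1 where \<delta>1: "gauge_fun_on (interior G) \<delta>1"
        "\<And>\<pi>. hk_partition_in (interior G) \<pi> \<and> fine_partition \<delta>1 \<pi> \<Longrightarrow>
          norm (\<Sum>(t, I)\<in>\<pi>. measure lebesgue I *\<^sub>R f t - F I) < \<epsilon> / 2"
        using *[THEN conjunct1, unfolded henstock_primitive_def, rule_format, OF e2] by blast
      obtain \<delta>2 where \<delta>2: "gauge_fun_on (UNIV - interior G) \<delta>2"
        "\<forall>\<pi>. hk_partition_in UNIV \<pi> \<and> fst ` \<pi> \<subseteq> UNIV - interior G \<and> fine_partition \<delta>2 \<pi> \<longrightarrow>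
            (\<forall>D\<in>divisions_of (interior G).
              (\<forall>(t, I)\<in>\<pi>. (\<lambda>k. F (I \<inter> D k)) summable_on meeting_indices I D) \<and>
              norm (\<Sum>(t, I)\<in>\<pi>. \<Sum>\<^sub>\<infinity>k\<in>meeting_indices I D. F (I \<inter> D k)) < \<epsilon> / 2)"
        using *[THEN conjunct2, unfolded hk_negligible_variation_outside_interior_def
            hk_negligible_variation_over_def, THEN conjunct2, rule_format, OF e2]
        by (elim exE conjE) (rule that)
      have "\<forall>t\<in>interior G. \<exists>r>0. max_ball t r \<subseteq> interior G"
        using max_ball_subset_open[OF open_interior] by blast
      then obtain r where r: "\<And>t. t \<in> interior G \<Longrightarrow> r t > 0"
          "\<And>t. t \<in> interior G \<Longrightarrow> max_ball t (r t) \<subseteq> interior G"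
        by metis
      \<comment> \<open>The bound \<open>r t\<close> forces an interval tagged in the interior to
        stay in the interior, where the extension equals \<open>F\<close>.\<close>
      define \<delta> where "\<delta> t = (if t \<in> interior G then min (\<delta>1 t) (r t) else \<delta>2 t)" for t
      show "\<exists>\<delta>. gauge_fun_on UNIV \<delta> \<and>
          (\<forall>\<pi>. hk_partition_in UNIV \<pi> \<and> fine_partition \<delta> \<pi> \<longrightarrow> norm (?S \<pi>) < \<epsilon>)"
      proof (intro exI[of _ \<delta>] conjI allI impI)
        show "gauge_fun_on UNIV \<delta>"
          using \<delta>1(1) \<delta>2(1) r(1) by (simp add: gauge_fun_on_def \<delta>_def)
        fix \<pi> assume \<pi>: "hk_partition_in UNIV \<pi> \<and> fine_partition \<delta> \<pi>"
        define \<pi>1 \<pi>2 where "\<pi>1 = {x \<in> \<pi>. fst x \<in> interior G}" and "\<pi>2 = {x \<in> \<pi>. fst x \<notin> interior G}"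
        have sub: "\<pi>1 \<subseteq> \<pi>" "\<pi>2 \<subseteq> \<pi>" and Un: "\<pi> = \<pi>1 \<union> \<pi>2" "\<pi>1 \<inter> \<pi>2 = {}"
          by (auto simp: \<pi>1_def \<pi>2_def)
        have fin: "finite \<pi>"
          using \<pi> by (auto simp: hk_partition_in_def dest: tagged_partial_division_ofD(1))
        have small1: "I \<subseteq> max_ball t (\<delta>1 t)" "I \<subseteq> max_ball t (r t)" "t \<in> interior G"
          if "(t, I) \<in> \<pi>1" for t I
        proof -
          have "t \<in> interior G" "I \<subseteq> max_ball t (\<delta> t)"
            using that \<pi> by (auto simp: \<pi>1_def fine_partition_def)
          then show "I \<subseteq> max_ball t (\<delta>1 t)" "I \<subseteq> max_ball t (r t)" "t \<in> interior G"
            by (auto simp: \<delta>_def max_ball_def)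
        qed
        have "hk_partition_in (interior G) \<pi>1"
        proof (rule hk_partition_in_subset[OF _ sub(1)])
          show "hk_partition_in UNIV \<pi>"
            using \<pi> by simp
          show "I \<subseteq> interior G" if "(t, I) \<in> \<pi>1" for t I
            using small1[OF that] r(2)[of t] by blast
        qed
        moreover have "fine_partition \<delta>1 \<pi>1"
          using small1(1) by (auto simp: fine_partition_def)
        ultimately have 1: "norm (?S \<pi>1) < \<epsilon> / 2"
          using \<delta>1(2) S_inside by simp
        have "hk_partition_in UNIV \<pi>2" and tags: "fst ` \<pi>2 \<subseteq> UNIV - interior G"
          using \<pi> hk_partition_in_subset[OF _ sub(2)] by (auto simp: \<pi>2_def)
        moreover have "fine_partition \<delta>2 \<pi>2"
          unfolding fine_partition_def
        proof clarify
          fix t I s assume "(t, I) \<in> \<pi>2" "s \<in> I"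
          then have "t \<notin> interior G" "s \<in> max_ball t (\<delta> t)"
            using \<pi> by (auto simp: \<pi>2_def fine_partition_def)
          then show "s \<in> max_ball t (\<delta>2 t)"
            by (simp add: \<delta>_def)
        qed
        ultimately have "norm (\<Sum>(t, I)\<in>\<pi>2. \<Sum>\<^sub>\<infinity>k\<in>meeting_indices I C. F (I \<inter> C k)) < \<epsilon> / 2"
          using \<delta>2(2) C by blast
        then have 2: "norm (?S \<pi>2) < \<epsilon> / 2"
          using S_outside[OF \<open>hk_partition_in UNIV \<pi>2\<close> tags C] by simp
        have "?S \<pi> = ?S \<pi>1 + ?S \<pi>2"
          unfolding Un(1) using fin sub Un(2)
          by (intro sum.union_disjoint) (auto intro: finite_subset)
        then show "norm (?S \<pi>) < \<epsilon>"
          using 1 2 norm_triangle_ineq[of "?S \<pi>1" "?S \<pi>2"] by simp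
      qed
    qed
  qed
qed

section \<open>Primitives as integrals over subintervals, and the three statements\<close>

lemma indicator_scaleR_has_integral_iff:
  fixes f :: "real ^ 'm \<Rightarrow> 'a::banach"
  assumes "I \<subseteq> W"
  shows "((\<lambda>t. indicat_real I t *\<^sub>R f t) has_integral i) W \<longleftrightarrow> (f has_integral i) I"
proof -
  have "(\<lambda>t. indicat_real I t *\<^sub>R f t) = (\<lambda>t. if t \<in> I then f t else 0)"
    by (auto simp: indicator_def)
  then show ?thesis
    using has_integral_restrict[OF assms, of f i] by simp
qed

text \<open>The indicator moves the domain of integration from \<open>W\<close> to \<open>I\<close>.
  Integrability on \<open>W\<close> is the case \<open>I = W\<close>, as \<open>W\<close> is one of
  its own intervals.\<close>

lemma hk_integrable_with_primitive_iff:
  fixes f :: "real ^ 'm \<Rightarrow> 'a::banach"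
  assumes "W \<in> intervals_in UNIV"
  shows "hk_integrable_with_primitive W f F \<longleftrightarrow> (\<forall>I\<in>intervals_in W. (f has_integral F I) I)"
proof -
  have "W \<in> intervals_in W"
    using assms by (simp add: intervals_in_iff)
  moreover have "((\<lambda>t. indicat_real I t *\<^sub>R f t) has_integral F I) W \<longleftrightarrow> (f has_integral F I) I"
    if "I \<in> intervals_in W" for I
    using that by (intro indicator_scaleR_has_integral_iff) (simp add: intervals_in_iff)
  ultimately show ?thesis
    unfolding hk_integrable_with_primitive_def by (metis has_integral_integrable)
qed

theorem theorem3p6:
  fixes G I0 :: "(real ^ 'm) set"
    and f f0 :: "real ^ 'm \<Rightarrow> 'a::banach"
    and F :: "(real ^ 'm) set \<Rightarrow> 'a"
  assumes "bounded G"
    and "interior G \<noteq> {}"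
    and "G - interior G \<in> null_sets lebesgue"
    and "I0 \<in> intervals_in UNIV"
    and "G \<subseteq> I0"
    and "additive_interval_function G F"
    and "\<And>t. t \<in> G \<Longrightarrow> f0 t = f t"
    and "\<And>t. t \<in> I0 - G \<Longrightarrow> f0 t = 0"
  shows
    "(dhk_integrable_with_primitive G f F \<longleftrightarrow>
       (\<exists>F0. hk_integrable_with_primitive I0 f0 F0 \<and>
          (\<forall>C\<in>divisions_of (interior G). \<forall>I\<in>intervals_in I0.
             ((\<lambda>k. F (I \<inter> C k)) has_sum F0 I) (meeting_indices I C))) \<and>
       dunford_function G F) \<and>
     (dhk_integrable_with_primitive G f F \<longleftrightarrow>
       dunford_function G F \<and>
       hk_negligible_variation_outside_interior G F \<and>
       (\<forall>C\<in>divisions_of (interior G). \<forall>k.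
          hk_integrable_with_primitive (C k) f F))"
proof -
  let ?U = "interior G"
  have boundedU: "bounded ?U"
    using \<open>bounded G\<close> interior_subset by (rule bounded_subset)
  \<comment> \<open>A single interval in the nonempty interior suffices to produce a division of
    it.\<close>
  obtain W :: "nat \<Rightarrow> (real ^ 'm) set" where "W 0 \<in> intervals_in ?U"
    using countable_interval_cover[OF open_interior \<open>?U \<noteq> {}\<close>] by metis
  then obtain C where C: "C \<in> divisions_of ?U"
    using division_of_open_containing[OF open_interior boundedU] by metis
  have C': "C \<in> divisions_in G"
    using C by (rule divisions_of_interior)
  define \<Phi> where "\<Phi> = extension F C"
  \<comment> \<open>On \<open>I0\<close>, \<open>g\<close> differs from \<open>f0\<close> only on
    the null set \<open>G - ?U\<close>, where \<open>g\<close> is zero.\<close>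
  define g where "g t = (if t \<in> ?U then f t else 0)" for t
  have dhk: "dhk_integrable_with_primitive G f F \<longleftrightarrow>
      henstock_primitive ?U f F \<and> dunford_function G F \<and>
      hk_negligible_variation_outside_interior G F"
    by (simp add: dhk_integrable_with_primitive_def henstock_primitive_def)
  \<comment> \<open>The common form of (i) and (ii): for a Dunford-function, both say that
    \<open>\<Phi>\<close> is the indefinite integral of \<open>g\<close> on all intervals of the
    space.\<close>
  have dhk_iff: "dhk_integrable_with_primitive G f F \<longleftrightarrow>
      (\<forall>I\<in>intervals_in UNIV. (g has_integral \<Phi> I) I)"
    if F: "dunford_function G F"
  proof -
    have "dhk_integrable_with_primitive G f F \<longleftrightarrow> henstock_primitive UNIV g \<Phi>"
      using henstock_primitive_UNIV_iff[OF F C, of f] F by (simp add: dhk g_def[abs_def] \<Phi>_def)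
    also have "\<dots> \<longleftrightarrow> (\<forall>I\<in>intervals_in UNIV. (g has_integral \<Phi> I) I)"
    proof
      assume "henstock_primitive UNIV g \<Phi>"
      then show "\<forall>I\<in>intervals_in UNIV. (g has_integral \<Phi> I) I"
        using has_integral_if_henstock_primitive[OF operative_extension[OF F C']]
        by (simp add: \<Phi>_def)
    next
      assume "\<forall>I\<in>intervals_in UNIV. (g has_integral \<Phi> I) I"
      then show "henstock_primitive UNIV g \<Phi>"
        by (intro henstock_primitive_if_has_integral[OF open_UNIV]) simp
    qed
    finally show ?thesis .
  qed
  have G0: "negligible (G - ?U)"
    using assms(3) by (simp add: negligible_iff_null_sets)
  have f0_iff: "(f0 has_integral i) I \<longleftrightarrow> (g has_integral i) I" if "I \<subseteq> I0" for I i
  proof (rule has_integral_spike_eq[OF G0])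
    fix t assume "t \<in> I - (G - ?U)"
    then show "g t = f0 t"
      using that assms(7)[of t] assms(8)[of t] interior_subset[of G] by (auto simp: g_def)
  qed
  have I0_iff: "(\<exists>F0. hk_integrable_with_primitive I0 f0 F0 \<and>
          (\<forall>C\<in>divisions_of ?U. \<forall>I\<in>intervals_in I0.
             ((\<lambda>k. F (I \<inter> C k)) has_sum F0 I) (meeting_indices I C))) \<longleftrightarrow>
      (\<forall>I\<in>intervals_in UNIV. (g has_integral \<Phi> I) I)" (is "?ex \<longleftrightarrow> ?all")
    if F: "dunford_function G F"
  proof
    assume ?ex
    then obtain F0 where F0: "hk_integrable_with_primitive I0 f0 F0"
      "\<forall>C\<in>divisions_of ?U. \<forall>I\<in>intervals_in I0.
        ((\<lambda>k. F (I \<inter> C k)) has_sum F0 I) (meeting_indices I C)"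
      by (elim exE conjE) (rule that)
    have F0_int: "(g has_integral \<Phi> I) I" if I: "I \<in> intervals_in I0" for I
    proof -
      have "(f0 has_integral F0 I) I"
        using F0(1)[unfolded hk_integrable_with_primitive_iff[OF assms(4)], rule_format, OF I] .
      moreover have "I \<subseteq> I0"
        using I by (simp add: intervals_in_iff)
      moreover have "F0 I = \<Phi> I"
        using infsumI[OF F0(2)[rule_format, OF C I]]
          infsum_meeting_indices[OF intervals_in_mono[OF I subset_UNIV] C', of F]
        by (simp add: \<Phi>_def)
      ultimately show ?thesis
        using f0_iff by simp
    qed
    show ?all
    proof
      fix I :: "(real ^ 'm) set" assume I: "I \<in> intervals_in UNIV"
      \<comment> \<open>Outside \<open>I0\<close> there are no members of \<open>C\<close>, and
        \<open>g\<close> is zero. Hence both \<open>\<Phi> I\<close> and the integral of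
        \<open>g\<close> depend only on \<open>I \<inter> I0\<close>, which is an interval in
        \<open>I0\<close> or a null set.\<close>
      have "C k \<subseteq> I0" for k
        using division_interval[OF C', of k] assms(5) by (auto simp: intervals_in_iff)
      then have "I \<inter> C k = (I \<inter> I0) \<inter> C k" for k
        by blast
      then have \<Phi>_eq: "\<Phi> I = \<Phi> (I \<inter> I0)"
        unfolding \<Phi>_def extension_def by simp
      have "(g has_integral \<Phi> (I \<inter> I0)) (I \<inter> I0)"
      proof (cases "interior (I \<inter> I0) = {}")
        case True
        then have "nondeg F (I \<inter> I0 \<inter> C k) = 0" for k
          by (rule nondeg_subset) blast
        then have "\<Phi> (I \<inter> I0) = 0"
          by (simp add: \<Phi>_def extension_def)
        moreover have "negligible (I \<inter> I0)"
          using negligible_Int_intervals[OF I assms(4)] True by simp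
        ultimately show ?thesis
          using has_integral_negligible[of "I \<inter> I0" "I \<inter> I0" g] by simp
      next
        case False
        then have "I \<inter> I0 \<in> intervals_in (UNIV \<inter> UNIV)"
          by (rule intervals_in_Int[OF I assms(4)])
        then have "I \<inter> I0 \<in> intervals_in I0"
          by (simp add: intervals_in_iff)
        then show ?thesis
          by (rule F0_int)
      qed
      then have "((\<lambda>t. if t \<in> I0 then g t else 0) has_integral \<Phi> I) I"
        unfolding has_integral_restrict_Int \<Phi>_eq by (simp only: Int_commute)
      moreover have "(\<lambda>t. if t \<in> I0 then g t else 0) = g"
        using subset_trans[OF interior_subset assms(5)] by (intro ext) (auto simp: g_def)
      ultimately show "(g has_integral \<Phi> I) I"
        by simp
    qed
  next
    assume all: ?all
    have "hk_integrable_with_primitive I0 f0 \<Phi>"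
      unfolding hk_integrable_with_primitive_iff[OF assms(4)]
    proof
      fix I assume I: "I \<in> intervals_in I0"
      then have "I \<subseteq> I0" "I \<in> intervals_in UNIV"
        by (simp_all add: intervals_in_iff)
      then show "(f0 has_integral \<Phi> I) I"
        using all by (simp add: f0_iff)
    qed
    \<comment> \<open>The witness \<open>\<Phi>\<close> was built from \<open>C\<close>;
      independence of the division makes it the sum for every \<open>D\<close>.\<close>
    moreover have "((\<lambda>k. F (I \<inter> D k)) has_sum \<Phi> I) (meeting_indices I D)"
      if D: "D \<in> divisions_of ?U" and "I \<in> intervals_in I0" for D I
    proof -
      have I: "I \<in> intervals_in UNIV"
        using that(2) by (simp add: intervals_in_iff)
      have D': "D \<in> divisions_in G"
        using D by (rule divisions_of_interior)
      show ?thesis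
        using dunford_function_has_sum_extension[OF F D' I]
        unfolding \<Phi>_def extension_independent[OF F I C D] has_sum_meeting_indices_iff[OF I D'] .
    qed
    ultimately show ?ex
      by (intro exI[of _ \<Phi>] conjI ballI)
  qed
  have i_iii: "dunford_function G F \<and> hk_negligible_variation_outside_interior G F \<and>
      (\<forall>C\<in>divisions_of ?U. \<forall>k. hk_integrable_with_primitive (C k) f F)"
    if I: "dhk_integrable_with_primitive G f F"
  proof -
    have F: "dunford_function G F" and "hk_negligible_variation_outside_interior G F"
      using I by (simp_all add: dhk)
    moreover have "hk_integrable_with_primitive (D k) f F" if D: "D \<in> divisions_of ?U" for D k
    proof -
      have D': "D k \<in> intervals_in ?U"
        using D unfolding divisions_of_def divisions_in_def by blast
      \<comment> \<open>Inside the interior \<open>g\<close> equals \<open>f\<close> and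
        \<open>\<Phi>\<close> equals \<open>F\<close>.\<close>
      have "(f has_integral F J) J" if "J \<in> intervals_in (D k)" for J
      proof -
        have J: "J \<in> intervals_in G" "J \<in> intervals_in UNIV" "J \<subseteq> ?U"
          using D' that interior_subset[of G] by (auto simp: intervals_in_iff)
        have "(g has_integral \<Phi> J) J"
          using I J(2) by (simp add: dhk_iff[OF F])
        then have "(g has_integral F J) J"
          using extension_eq[OF F C J(1)] by (simp add: \<Phi>_def)
        then show ?thesis
          by (rule has_integral_eq[rotated]) (use J(3) in \<open>auto simp: g_def\<close>)
      qed
      moreover have "D k \<in> intervals_in UNIV"
        using D' by (simp add: intervals_in_iff)
      ultimately show ?thesis
        by (simp add: hk_integrable_with_primitive_iff)
    qed
    ultimately show ?thesis
      by (intro conjI ballI allI)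
  qed
  have iii_i: "dhk_integrable_with_primitive G f F"
    if F: "dunford_function G F" and "hk_negligible_variation_outside_interior G F"
      and all: "\<forall>C\<in>divisions_of ?U. \<forall>k. hk_integrable_with_primitive (C k) f F"
  proof -
    have "(f has_integral F J) J" if J: "J \<in> intervals_in ?U" for J
    proof -
      \<comment> \<open>With \<open>J\<close> as a member of a division, the hypothesis on divisions
        yields the integral over \<open>J\<close> itself.\<close>
      obtain D where D: "D \<in> divisions_of ?U" "D 0 = J"
        using division_of_open_containing[OF open_interior boundedU J] by metis
      then have "hk_integrable_with_primitive J f F"
        using all[rule_format, OF D(1), of 0] by simp
      moreover have "J \<in> intervals_in UNIV" "J \<in> intervals_in J"
        using J by (simp_all add: intervals_in_iff)
      ultimately show ?thesis
        by (simp add: hk_integrable_with_primitive_iff)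
    qed
    then have "henstock_primitive ?U f F"
      by (rule henstock_primitive_if_has_integral[OF open_interior])
    then show ?thesis
      using that(1,2) by (simp add: dhk)
  qed
  have i_ii: "dhk_integrable_with_primitive G f F \<longleftrightarrow>
      (\<exists>F0. hk_integrable_with_primitive I0 f0 F0 \<and>
          (\<forall>C\<in>divisions_of ?U. \<forall>I\<in>intervals_in I0.
             ((\<lambda>k. F (I \<inter> C k)) has_sum F0 I) (meeting_indices I C))) \<and>
       dunford_function G F"
  \<comment> \<open>The extension is meaningful only for a Dunford-function; for any other
    \<open>F\<close> both sides are false.\<close>
  proof (cases "dunford_function G F")
    case True
    then show ?thesis
      by (simp only: dhk_iff[OF True] I0_iff[OF True] simp_thms)
  next
    case False
    then show ?thesis
      by (simp add: dhk)
  qed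
  show ?thesis
    by (intro conjI[OF i_ii] iffI; (elim conjE)?) (erule i_iii, rule iii_i)
qed

end
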